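(* Let $a\in\mathbb{R}$, $n\in\mathbb{Z}_+$, $\alpha\in(n-1,n)$, and let $x:\mathbb{N}_{a+1-n}\to\mathbb{R}$ and $w:\mathbb{N}_{a+1-n}\to\mathbb{R}\setminus\{0\}$. Then for every $k\in\mathbb{N}_{a+1}$: $${}_a^{\rm R}\nabla_k^{\alpha,w(k)}\,{}_a^{\rm G}\nabla_k^{-\alpha,w(k)}x(k)={}_a^{\rm C}\nabla_k^{\alpha,w(k)}\,{}_a^{\rm G}\nabla_k^{-\alpha,w(k)}x(k)=x(k),$$ $${}_a^{\rm G}\nabla_k^{-\alpha,w(k)}\,{}_a^{\rm R}\nabla_k^{\alpha,w(k)}x(k)=x(k)-\sum_{i=0}^{n-1}\frac{(k-a)^{\overline{\alpha-i-1}}}{\Gamma(\alpha-i)}\,\frac{w(a)}{w(k)}\,\bigl[{}_a^{\rm R}\nabla_k^{\alpha-i-1,w(k)}x(k)\bigr]_{k=a},$$ $${}_a^{\rm G}\nabla_k^{-\alpha,w(k)}\,{}_a^{\rm C}\nabla_k^{\alpha,w(k)}x(k)=x(k)-\sum_{i=0}^{n-1}\frac{(k-a)^{\overline{i}}}{i!}\,\frac{w(a)}{w(k)}\,\bigl[\nabla^{i,w(k)}x(k)\bigr]_{k=a}.$$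
   Context: For $b\in\mathbb{R}$, $\mathbb{N}_b=\{b,b+1,b+2,\dots\}$; $\mathbb{Z}_+=\{1,2,\dots\}$. $p^{\overline{q}}=\Gamma(p+q)/\Gamma(p)$ is the rising function. $\binom{p}{i}=\frac{p(p-1)\cdots(p-i+1)}{i!}$ for real $p$ and integer $i\ge 0$. Nabla difference: $\nabla^n z(k)=\sum_{i=0}^n(-1)^i\binom{n}{i}z(k-i)$, with $\nabla^0 z=z$. Grünwald–Letnikov difference/sum of order $\alpha\in\mathbb{R}$: ${}_a^{\rm G}\nabla_k^\alpha z(k)=\sum_{i=0}^{k-a-1}(-1)^i\binom{\alpha}{i}z(k-i)$; empty sums are $0$, so this equals $0$ at $k=a,a-1,\dots$. For $\alpha\in(n-1,n)$, Riemann–Liouville: ${}_a^{\rm R}\nabla_k^\alpha z(k)=\nabla^n\,{}_a^{\rm G}\nabla_k^{\alpha-n}z(k)$; Caputo: ${}_a^{\rm C}\nabla_k^\alpha z(k)={}_a^{\rm G}\nabla_k^{\alpha-n}\nabla^n z(k)$. For $0\le i\le n-1$, ${}_a^{\rm R}\nabla_k^{\alpha-i-1}z(k)=\nabla^{n-i-1}{}_a^{\rm G}\nabla_k^{\alpha-n}z(k)$; in particular for $i=n-1$ (negative order) it means ${}_a^{\rm G}\nabla_k^{\alpha-n}z(k)$. Tempered versions, with tempered function $w$ (nowhere zero): for each of the operators $D$ among $\nabla^n$, ${}_a^{\rm G}\nabla_k^\alpha$, ${}_a^{\rm R}\nabla_k^\alpha$, ${}_a^{\rm C}\nabla_k^\alpha$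 the tempered operator (written with the extra superscript $w(k)$) sends $x$ to $w^{-1}(k)\,D[w(k)x(k)]$, where $w^{-1}(k)=1/w(k)$. $[\,\cdot\,]_{k=a}$ denotes evaluation at $k=a$. *)

theory Defs
  imports "HOL-Analysis.Analysis"
begin

definition nat_from :: "real \<Rightarrow> real set" where
  "nat_from b = {b + real i | i :: nat. True}"

definition rising :: "real \<Rightarrow> real \<Rightarrow> real" where
  "rising p q = Gamma (p + q) / Gamma p"

text \<open>
  A function on a grid \<open>nat_from b\<close> is represented by a total function on the reals; on the grid
  points considered, the operators only read values at grid points.
\<close>

definition nabla :: "nat \<Rightarrow> (real \<Rightarrow> real) \<Rightarrow> real \<Rightarrow> real" where
  "nabla n z k = (\<Sum>i=0..n. (-1) ^ i * real (n choose i) * z (k - real i))"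

text \<open>
  The upper summation bound \<open>k - a - 1\<close> is a real number that may be negative; for \<open>k \<le> a\<close> the
  index set is empty and the value is 0.
\<close>

definition GL :: "real \<Rightarrow> real \<Rightarrow> (real \<Rightarrow> real) \<Rightarrow> real \<Rightarrow> real" where
  "GL a \<alpha> z k =
     (\<Sum>i \<in> {i :: nat. real i \<le> k - a - 1}. (-1) ^ i * (\<alpha> gchoose i) * z (k - real i))"

text \<open>
  For \<open>n - 1 < \<alpha> < n\<close> the integer \<open>n\<close> is the ceiling of \<open>\<alpha>\<close>. Truncating it at 0 gives the
  convention that an operator of negative order is the Gruenwald-Letnikov sum of that order.
  Only noninteger orders are meant here.
\<close>

definition RL :: "real \<Rightarrow> real \<Rightarrow> (real \<Rightarrow> real) \<Rightarrow> real \<Rightarrow> real" where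
  "RL a \<alpha> z = nabla (nat \<lceil>\<alpha>\<rceil>) (GL a (\<alpha> - real (nat \<lceil>\<alpha>\<rceil>)) z)"

definition Caputo :: "real \<Rightarrow> real \<Rightarrow> (real \<Rightarrow> real) \<Rightarrow> real \<Rightarrow> real" where
  "Caputo a \<alpha> z = GL a (\<alpha> - real (nat \<lceil>\<alpha>\<rceil>)) (nabla (nat \<lceil>\<alpha>\<rceil>) z)"

definition tempered ::
  "(real \<Rightarrow> real) \<Rightarrow> ((real \<Rightarrow> real) \<Rightarrow> real \<Rightarrow> real) \<Rightarrow> (real \<Rightarrow> real) \<Rightarrow> real \<Rightarrow> real" where
  "tempered w D x k = (1 / w k) * D (\<lambda>j. w j * x j) k"

lemma nat_ceiling_eq:
  assumes "real n - 1 < \<alpha>" "\<alpha> < real n"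
  shows "nat \<lceil>\<alpha>\<rceil> = n"
proof -
  have "\<lceil>\<alpha>\<rceil> = int n"
    using assms by (intro ceiling_unique) auto
  then show ?thesis by simp
qed

lemma RL_eq:
  assumes "real n - 1 < \<alpha>" "\<alpha> < real n"
  shows "RL a \<alpha> z = nabla n (GL a (\<alpha> - real n) z)"
  using nat_ceiling_eq[OF assms] by (simp add: RL_def)

lemma Caputo_eq:
  assumes "real n - 1 < \<alpha>" "\<alpha> < real n"
  shows "Caputo a \<alpha> z = GL a (\<alpha> - real n) (nabla n z)"
  using nat_ceiling_eq[OF assms] by (simp add: Caputo_def)

lemma RL_lower_order_eq:
  assumes "real n - 1 < \<alpha>" "\<alpha> < real n" "i < n"
  shows "RL a (\<alpha> - real i - 1) z = nabla (n - i - 1) (GL a (\<alpha> - real n) z)"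
proof -
  have r: "real (n - i - 1) = real n - real i - 1"
    using assms(3) by (simp add: of_nat_diff)
  have "RL a (\<alpha> - real i - 1) z =
      nabla (n - i - 1) (GL a (\<alpha> - real i - 1 - real (n - i - 1)) z)"
    by (rule RL_eq) (use assms r in linarith)+
  also have "\<alpha> - real i - 1 - real (n - i - 1) = \<alpha> - real n"
    using r by linarith
  finally show ?thesis .
qed

end

theory Submission
  imports Defs
begin

unbundle no vec_syntax
unbundle fps_syntax

text \<open>
  Encode a function on the grid \<open>a + 1, a + 2, \<dots>\<close> as a formal power series. The
  Gruenwald-Letnikov operator of order \<open>\<beta>\<close> then becomes multiplication by \<open>(1 - X)\<^sup>\<beta>\<close>, and a
  backward difference becomes multiplication by \<open>1 - X\<close> minus the value at \<open>a\<close>. All the identities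
  follow from \<open>(1 - X)\<^sup>\<beta> (1 - X)\<^sup>\<gamma> = (1 - X)\<^sup>\<beta>\<^sup>+\<^sup>\<gamma>\<close>. Gruenwald-Letnikov sums vanish at
  \<open>a, a - 1, \<dots>\<close>, so every initial value in the Riemann-Liouville formula is 0.
\<close>

definition one_minus_X_powr :: "real \<Rightarrow> real fps" where
  "one_minus_X_powr \<beta> = Abs_fps (\<lambda>i. (-1) ^ i * (\<beta> gchoose i))"

text \<open>Vandermonde convolution: the signs combine to \<open>(-1) ^ m\<close>, which leaves the
  product rule for the binomial series \<open>fps_binomial\<close>.\<close>

lemma one_minus_X_powr_add:
  "one_minus_X_powr (\<beta> + \<gamma>) = one_minus_X_powr \<beta> * one_minus_X_powr \<gamma>"
proof (rule fps_ext)
  fix m :: nat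
  have "(one_minus_X_powr \<beta> * one_minus_X_powr \<gamma>) $ m
      = (\<Sum>i=0..m. (-1) ^ m * ((\<beta> gchoose i) * (\<gamma> gchoose (m - i))))"
    unfolding fps_mult_nth one_minus_X_powr_def fps_nth_Abs_fps
  proof (rule sum.cong[OF refl])
    fix i assume "i \<in> {0..m}"
    then have "(-1 :: real) ^ m = (-1) ^ i * (-1) ^ (m - i)"
      by (simp flip: power_add)
    then show "(-1) ^ i * (\<beta> gchoose i) * ((-1) ^ (m - i) * (\<gamma> gchoose (m - i)))
        = (-1) ^ m * ((\<beta> gchoose i) * (\<gamma> gchoose (m - i)))"
      by simp
  qed
  also have "\<dots> = (-1) ^ m * ((fps_binomial \<beta> * fps_binomial \<gamma>) $ m)"
    by (simp add: fps_mult_nth sum_distrib_left)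
  also have "\<dots> = one_minus_X_powr (\<beta> + \<gamma>) $ m"
    by (simp add: one_minus_X_powr_def flip: fps_binomial_add_mult)
  finally show "one_minus_X_powr (\<beta> + \<gamma>) $ m
      = (one_minus_X_powr \<beta> * one_minus_X_powr \<gamma>) $ m" by simp
qed

lemma one_minus_X_powr_mult_assoc:
  "one_minus_X_powr \<beta> * (one_minus_X_powr \<gamma> * f) = one_minus_X_powr (\<beta> + \<gamma>) * f"
  by (simp add: one_minus_X_powr_add mult.assoc)

lemma one_minus_X_powr_0: "one_minus_X_powr 0 = 1"
  by (rule fps_ext) (simp add: one_minus_X_powr_def gbinomial_0_left)

lemma one_minus_X_powr_1: "one_minus_X_powr 1 = 1 - fps_X"
proof (rule fps_ext)
  fix m :: nat
  have "(1 :: real) gchoose m = of_nat (1 choose m)"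
    by (simp add: binomial_gbinomial)
  then show "one_minus_X_powr 1 $ m = (1 - fps_X) $ m"
    by (cases m rule: nat.exhaust[case_product nat.exhaust])
       (auto simp: one_minus_X_powr_def fps_X_def binomial_eq_0)
qed

text \<open>Upper negation turns the coefficient into an ordinary binomial coefficient. At k = a + 1
  + m the argument m + 1 is k - a, so these are the kernels of the Caputo formula.\<close>

lemma one_minus_X_powr_neg_Suc_nth:
  "one_minus_X_powr (- 1 - real i) $ m = rising (real m + 1) (real i) / fact i"
proof -
  have "(- 1 - real i) gchoose m = (-1) ^ m * ((real i + real m) gchoose m)"
    by (subst gbinomial_negated_upper) (simp add: algebra_simps)
  also have "(real i + real m) gchoose m = real ((i + m) choose m)"
    by (simp add: binomial_gbinomial)
  also have "\<dots> = fact (i + m) / (fact m * fact i)"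
    by (simp add: binomial_fact)
  finally have "one_minus_X_powr (- 1 - real i) $ m = fact (i + m) / (fact m * fact i)"
    by (simp add: one_minus_X_powr_def flip: power_mult_distrib mult.assoc)
  moreover have "rising (real m + 1) (real i) = fact (i + m) / fact m"
    using Gamma_fact[of "i + m", where 'a = real] Gamma_fact[of m, where 'a = real]
    by (simp add: rising_def ac_simps)
  ultimately show ?thesis by simp
qed

definition grid_fps :: "real \<Rightarrow> (real \<Rightarrow> real) \<Rightarrow> real fps" where
  "grid_fps a z = Abs_fps (\<lambda>j. z (a + 1 + real j))"

text \<open>At k = a + 1 + m the summation bound k - a - 1 is exactly m, so the sum is a Cauchy
  product.\<close>

lemma GL_grid: "GL a \<beta> z (a + 1 + real m) = (one_minus_X_powr \<beta> * grid_fps a z) $ m"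
proof -
  have "{i :: nat. real i \<le> a + 1 + real m - a - 1} = {0..m}" by auto
  moreover have "z (a + 1 + real m - real i) = z (a + 1 + real (m - i))" if "i \<le> m" for i
    using that by (simp add: of_nat_diff algebra_simps)
  ultimately show ?thesis
    by (auto simp: GL_def fps_mult_nth one_minus_X_powr_def grid_fps_def intro!: sum.cong)
qed

lemma grid_fps_GL: "grid_fps a (GL a \<beta> z) = one_minus_X_powr \<beta> * grid_fps a z"
  by (rule fps_ext) (simp add: GL_grid[symmetric], simp add: grid_fps_def)

lemma GL_eq_0: "k \<le> a \<Longrightarrow> GL a \<beta> z k = 0"
  by (auto simp: GL_def intro!: sum.neutral)

lemma nabla_Suc: "nabla (Suc n) z k = nabla n z k - nabla n z (k - 1)"
proof -
  let ?t = "\<lambda>m i. (-1) ^ i * real (m choose i) * z (k - real i)"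
  have "nabla (Suc n) z k = z k + (\<Sum>i=0..n. ?t (Suc n) (Suc i))"
    unfolding nabla_def by (subst sum.atLeast0_atMost_Suc_shift) simp
  also have "(\<Sum>i=0..n. ?t (Suc n) (Suc i))
      = (\<Sum>i=0..n. ?t n (Suc i)) - (\<Sum>i=0..n. (-1) ^ i * real (n choose i) * z (k - 1 - real i))"
    unfolding sum_subtractf[symmetric]
    by (intro sum.cong) (simp_all add: algebra_simps)
  also have "z k + (\<dots>) = (\<Sum>i=0..Suc n. ?t n i) - nabla n z (k - 1)"
    unfolding nabla_def by (subst sum.atLeast0_atMost_Suc_shift) simp
  \<comment> \<open>The additional last term carries the factor \<open>n choose Suc n\<close>, which
    is 0.\<close>
  also have "(\<Sum>i=0..Suc n. ?t n i) = nabla n z k"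
    by (simp add: nabla_def)
  finally show ?thesis .
qed

text \<open>Multiplication by 1 - X treats the value before the first grid point as 0, whereas the
  difference at a + 1 subtracts the value at a. Only the constant coefficient needs
  correcting.\<close>

lemma grid_fps_nabla_Suc:
  "grid_fps a (nabla (Suc n) z)
     = one_minus_X_powr 1 * grid_fps a (nabla n z) - fps_const (nabla n z a)"
proof (rule fps_ext)
  fix m :: nat
  show "grid_fps a (nabla (Suc n) z) $ m
      = (one_minus_X_powr 1 * grid_fps a (nabla n z) - fps_const (nabla n z a)) $ m"
    by (cases m) (simp_all add: grid_fps_def nabla_Suc one_minus_X_powr_1 left_diff_distrib add.assoc)
qed

text \<open>The correction made when passing from order i to i + 1 is multiplied by 1 - X in each of
  the remaining n - 1 - i steps.\<close>

lemma grid_fps_nabla: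
  "grid_fps a (nabla n z) = one_minus_X_powr (real n) * grid_fps a z
     - (\<Sum>i<n. one_minus_X_powr (real n - 1 - real i) * fps_const (nabla i z a))"
proof (induction n)
  case 0
  show ?case by (simp add: one_minus_X_powr_0 nabla_def)
next
  case (Suc n)
  show ?case
    unfolding grid_fps_nabla_Suc Suc
    by (simp add: one_minus_X_powr_0 right_diff_distrib sum_distrib_left
        one_minus_X_powr_mult_assoc)
qed

lemma nabla_eq_0:
  assumes "\<And>r. z (a - real r) = 0"
  shows "nabla n z a = 0"
  using assms by (simp add: nabla_def)

lemma grid_fps_nabla_vanishing:
  assumes "\<And>r. z (a - real r) = 0"
  shows "grid_fps a (nabla n z) = one_minus_X_powr (real n) * grid_fps a z"
  by (simp add: grid_fps_nabla nabla_eq_0 assms)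

lemma grid_fps_RL:
  assumes "real n - 1 < \<alpha>" "\<alpha> < real n"
  shows "grid_fps a (RL a \<alpha> z) = one_minus_X_powr \<alpha> * grid_fps a z"
  unfolding RL_eq[OF assms]
  by (simp add: grid_fps_nabla_vanishing GL_eq_0 grid_fps_GL
      one_minus_X_powr_mult_assoc)

lemma grid_fps_Caputo:
  assumes "real n - 1 < \<alpha>" "\<alpha> < real n"
  shows "grid_fps a (Caputo a \<alpha> z) = one_minus_X_powr \<alpha> * grid_fps a z
     - (\<Sum>i<n. one_minus_X_powr (\<alpha> - 1 - real i) * fps_const (nabla i z a))"
  unfolding Caputo_eq[OF assms] grid_fps_GL grid_fps_nabla
  by (simp add: right_diff_distrib sum_distrib_left one_minus_X_powr_mult_assoc)
    (simp add: algebra_simps)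

lemma RL_lower_order_at_a:
  assumes "real n - 1 < \<alpha>" "\<alpha> < real n" "i < n"
  shows "RL a (\<alpha> - real i - 1) z a = 0"
  unfolding RL_lower_order_eq[OF assms] by (intro nabla_eq_0 GL_eq_0) simp

text \<open>In a composition, the outer factor w cancels the inner 1/w at every grid point after a,
  so tempered operators compose like the plain ones applied to w x.\<close>

lemma grid_fps_temper_cancel:
  assumes "\<And>j. w (a + 1 + real j) \<noteq> 0"
  shows "grid_fps a (\<lambda>j. w j * tempered w D x j) = grid_fps a (D (\<lambda>j. w j * x j))"
  using assms by (simp add: grid_fps_def tempered_def)

lemma one_minus_X_powr_inverse:
  "one_minus_X_powr \<beta> * (one_minus_X_powr (-\<beta>) * f) = f"
  "one_minus_X_powr (-\<beta>) * (one_minus_X_powr \<beta> * f) = f"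
  by (simp_all add: one_minus_X_powr_0 one_minus_X_powr_mult_assoc)

theorem theorem2:
  fixes a \<alpha> :: real and n :: nat and x w :: "real \<Rightarrow> real"
  assumes "n \<ge> 1"
    and "real n - 1 < \<alpha>" and "\<alpha> < real n"
    and "\<And>j. j \<in> nat_from (a + 1 - real n) \<Longrightarrow> w j \<noteq> 0"
    and "k \<in> nat_from (a + 1)"
  shows
    "(tempered w (RL a \<alpha>) (tempered w (GL a (-\<alpha>)) x) k
        = tempered w (Caputo a \<alpha>) (tempered w (GL a (-\<alpha>)) x) k
      \<and> tempered w (Caputo a \<alpha>) (tempered w (GL a (-\<alpha>)) x) k = x k)
     \<and> tempered w (GL a (-\<alpha>)) (tempered w (RL a \<alpha>) x) k
        = x k - (\<Sum>i=0..n-1. rising (k - a) (\<alpha> - real i - 1) / Gamma (\<alpha> - real i)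
                     * (w a / w k) * tempered w (RL a (\<alpha> - real i - 1)) x a)
     \<and> tempered w (GL a (-\<alpha>)) (tempered w (Caputo a \<alpha>) x) k
        = x k - (\<Sum>i=0..n-1. rising (k - a) (real i) / fact i
                     * (w a / w k) * tempered w (nabla i) x a)"
proof -
  obtain m where k: "k = a + 1 + real m"
    using assms(5) by (auto simp: nat_from_def)
  \<comment> \<open>The domain of w starts at a + 1 - n, so a + 1 + j has index j + n and a has
    index n - 1.\<close>
  have w_grid: "w (a + 1 + real j) \<noteq> 0" for j
    using assms(4)[of "a + 1 + real j"] by (force simp: nat_from_def intro!: exI[of _ "j + n"])
  have w_a: "w a \<noteq> 0"
    using assms(1) assms(4)[of a]
    by (force simp: nat_from_def of_nat_diff intro!: exI[of _ "n - 1"])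
  define z where "z = (\<lambda>j. w j * x j)"
  have temp: "tempered w D (tempered w E x) k = grid_fps a (D (\<lambda>j. w j * tempered w E x j)) $ m / w k"
    for D E by (simp add: tempered_def grid_fps_def k)
  have zk: "grid_fps a z $ m / w k = x k"
    using w_grid[of m] by (simp add: grid_fps_def z_def k)
  have cancel: "grid_fps a (\<lambda>j. w j * tempered w D x j) = grid_fps a (D z)" for D
    using grid_fps_temper_cancel[of w a D x] w_grid by (simp add: z_def)
  let ?y = "\<lambda>j. w j * tempered w (GL a (-\<alpha>)) x j"
  \<comment> \<open>The sum itself is 0 there, so this holds even at points left of the domain,
    where w may vanish. Hence the Caputo operator has no initial terms on \<open>?y\<close>.\<close>
  have "?y (a - real r) = 0" for r
    by (simp add: tempered_def GL_eq_0)
  then have nabla_y: "nabla i ?y a = 0" for i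
    by (rule nabla_eq_0)

  have RL_GL: "tempered w (RL a \<alpha>) (tempered w (GL a (-\<alpha>)) x) k = x k"
    by (simp add: temp grid_fps_RL[OF assms(2,3)] cancel grid_fps_GL one_minus_X_powr_inverse zk)
  have Caputo_GL: "tempered w (Caputo a \<alpha>) (tempered w (GL a (-\<alpha>)) x) k = x k"
    by (simp add: temp grid_fps_Caputo[OF assms(2,3)] nabla_y cancel grid_fps_GL
        one_minus_X_powr_inverse zk)
  have GL_RL: "tempered w (GL a (-\<alpha>)) (tempered w (RL a \<alpha>) x) k = x k"
    by (simp add: temp grid_fps_GL cancel grid_fps_RL[OF assms(2,3)] one_minus_X_powr_inverse zk)
  have RL_initial: "tempered w (RL a (\<alpha> - real i - 1)) x a = 0" if "i \<in> {0..n-1}" for i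
    using that assms(1) by (simp add: tempered_def RL_lower_order_at_a[OF assms(2,3)])

  \<comment> \<open>The exponents -\<alpha> and \<alpha> - 1 - i add up to -1 - i, so \<alpha>
    disappears from the initial terms.\<close>
  have "grid_fps a (GL a (-\<alpha>) (\<lambda>j. w j * tempered w (Caputo a \<alpha>) x j))
      = grid_fps a z - (\<Sum>i<n. one_minus_X_powr (- 1 - real i) * fps_const (nabla i z a))"
    unfolding grid_fps_GL cancel grid_fps_Caputo[OF assms(2,3)] right_diff_distrib
      one_minus_X_powr_inverse sum_distrib_left
    by (simp add: one_minus_X_powr_mult_assoc)
  then have "tempered w (GL a (-\<alpha>)) (tempered w (Caputo a \<alpha>) x) k
      = x k - (\<Sum>i<n. rising (real m + 1) (real i) / fact i * nabla i z a) / w k"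
    by (simp add: temp fps_sum_nth one_minus_X_powr_neg_Suc_nth diff_divide_distrib zk)
  \<comment> \<open>The factor w(a) undoes the 1/w(a) inside the tempered difference at a.\<close>
  also have "(\<Sum>i<n. rising (real m + 1) (real i) / fact i * nabla i z a) / w k
      = (\<Sum>i=0..n-1. rising (k - a) (real i) / fact i * (w a / w k) * tempered w (nabla i) x a)"
    unfolding sum_divide_distrib
    by (rule sum.cong) (use assms(1) w_a in \<open>auto simp: tempered_def z_def k add.commute\<close>)
  finally show ?thesis
    using RL_GL Caputo_GL GL_RL RL_initial by simp
qed

end
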